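(* Let $H=\langle m_0,\dots,m_p,n\rangle$ be a numerical semigroup minimally generated by an almost arithmetic sequence, with associated data as in the context, and assume $W=\emptyset$. Suppose $r=1$ and $\lambda>1$. Then for every element $\gamma_k$ of $\mathrm{PF}(H)$, $k\in[1,p]$, there exists an $\mathrm{RF}$-matrix for $\gamma_k$ whose rows (indexed by $0,1,\dots,p,n$) are: (1) row $0$: $-E_0+(q-1)E_p+(v-1)E_n+E_k$; (2) row $j$ for $j\in[1,p-k]$: $-E_j+(q-1)E_p+(v-1)E_n+E_{k+j}$; (3) row $j$ for $j\in[p-k+1,p]$: $(\lambda-2)E_0-E_j+(w+v-1)E_n+E_{k+j-p-1}$; (4) row $n$: $(\mu-1)E_0+(q+q_z-1)E_p-E_n+E_k+E_{r_z}$ if $\mu\ge1$, and $(\lambda-2)E_0+(q_z-1)E_p-E_n+E_{k-1}+E_{r_z}$ if $\mu=0$.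
   Context: Notation: $\mathbb N=\{0,1,2,\dots\}$; $[a,b]$ is the set of integers $i$ with $a\le i\le b$. Let $p\ge1$, $d\ge1$, $m_0\ge 1$ be integers, $m_i=m_0+id$ for $i\in[0,p]$, and $n\ge1$ an integer with $\gcd(m_0,d,n)=1$. Put $H'=\sum_{i=0}^p\mathbb Nm_i$ and $H=H'+\mathbb Nn=\langle m_0,\dots,m_p,n\rangle$; assume $\{m_0,\dots,m_p,n\}$ is a minimal generating set of $H$. $\mathrm{Ap}(H,m_0)=\{h\in H: h-m_0\notin H\}$. For $t\in\mathbb N$ write $t=q_tp+r_t$ with $q_t\in\mathbb Z$, $r_t\in[1,p]$, and set $g_t=q_tm_p+m_{r_t}$ (so $q_0=-1$, $r_0=p$, $g_0=0$). Let $u=\min\{t\in\mathbb N: g_t\notin\mathrm{Ap}(H,m_0)\}$ and $v=\min\{b\ge1: bn\in H'\}$. It is known (Patil–Singh) that there are unique integers $z\in[0,u-1]$, $w\in[0,v-1]$, $\lambda\ge1$, $\mu\ge0$ with $g_u=\lambda m_0+wn$, $vn=\mu m_0+g_z$, and $g_{u-z}+(v-w)n=\nu m_0$, where $\nu=\lambda+\mu+1$ if $r_{u-z}<r_u$ and $\nu=\lambda+\mu$ if $r_{u-z}\ge r_u$. Set $r=r_u$, $q=q_u$, $r'=r_{u-z}$, $q'=q_{u-z}$, and $W=[u-z,u-1]\times[v-w,v-1]$ (empty iff $z=0$ or $w=0$). $\mathrm{PF}(H)$ is the set of $f\in\mathbb Z\setminus H$ with $f+h\in H$ for all $h\in H\setminus\{0\}$.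 An $\mathrm{RF}$-matrix for $f\in\mathrm{PF}(H)$ is a $(p+2)\times(p+2)$ integer matrix with rows and columns indexed by $0,1,\dots,p,n$ (corresponding to the generators $m_0,\dots,m_p,n$), with all diagonal entries $-1$, all off-diagonal entries in $\mathbb N$, and such that each row $(b_0,\dots,b_p,b_n)$ satisfies $\sum_{j=0}^p b_jm_j+b_nn=f$. $E_0,\dots,E_p,E_n$ denote the standard basis vectors of $\mathbb Z^{p+2}$ (coordinates indexed by $0,\dots,p,n$). Let $\gamma_k=g_{(q-1)p+r+k-1}+(v-1)n-m_0$ for $k\in[1,p]$. It is known (Patil–Sengupta) that if $W=\emptyset$, then $\mathrm{PF}(H)=\{\gamma_k: k\in[1,p]\}$ if $r=1$ and $\mathrm{PF}(H)=\{\gamma_k: k\in[p-r+2,p]\}$ if $r\ge2$. *)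

theory Defs
  imports "Jordan_Normal_Form.Matrix"
begin

text \<open>For a finite set of integers: the additive monoid generated by it.\<close>

definition nat_span :: "int set \<Rightarrow> int set" where
  "nat_span S = {\<Sum>s\<in>S. int (c s) * s | c. True}"

definition minimal_generating_set :: "int set \<Rightarrow> int set \<Rightarrow> bool" where
  "minimal_generating_set S H \<longleftrightarrow> nat_span S = H \<and> (\<forall>T. T \<subset> S \<longrightarrow> nat_span T \<noteq> H)"

definition Apery :: "int set \<Rightarrow> int \<Rightarrow> int set" where
  "Apery H a = {h \<in> H. h - a \<notin> H}"

definition PF :: "int set \<Rightarrow> int set" where
  "PF H = {f. f \<notin> H \<and> (\<forall>h \<in> H - {0}. f + h \<in> H)}"

definition RF_matrix :: "int set \<Rightarrow> int vec \<Rightarrow> int \<Rightarrow> int mat \<Rightarrow> bool" where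
  "RF_matrix H gens f M \<longleftrightarrow>
     f \<in> PF H \<and>
     M \<in> carrier_mat (dim_vec gens) (dim_vec gens) \<and>
     (\<forall>i < dim_vec gens. M $$ (i, i) = -1) \<and>
     (\<forall>i < dim_vec gens. \<forall>j < dim_vec gens. i \<noteq> j \<longrightarrow> 0 \<le> M $$ (i, j)) \<and>
     (\<forall>i < dim_vec gens. row M i \<bullet> gens = f)"

definition arith_seq :: "int \<Rightarrow> int \<Rightarrow> nat \<Rightarrow> int" where
  "arith_seq m0 d i = m0 + int i * d"

definition arith_monoid :: "nat \<Rightarrow> int \<Rightarrow> int \<Rightarrow> int set" where
  "arith_monoid p m0 d = nat_span (arith_seq m0 d ` {0..p})"

definition almost_arith_gens :: "nat \<Rightarrow> int \<Rightarrow> int \<Rightarrow> int \<Rightarrow> int set" where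
  "almost_arith_gens p m0 d n = insert n (arith_seq m0 d ` {0..p})"

definition almost_arith_monoid :: "nat \<Rightarrow> int \<Rightarrow> int \<Rightarrow> int \<Rightarrow> int set" where
  "almost_arith_monoid p m0 d n = nat_span (almost_arith_gens p m0 d n)"

text \<open>The generators in order; position \<open>p + 1\<close> belongs to \<open>n\<close>.\<close>

definition gen_vec :: "nat \<Rightarrow> int \<Rightarrow> int \<Rightarrow> int \<Rightarrow> int vec" where
  "gen_vec p m0 d n = vec (p + 2) (\<lambda>i. if i \<le> p then arith_seq m0 d i else n)"

text \<open>
  Division of \<open>t\<close> by \<open>p\<close> with remainder in \<open>[1, p]\<close> instead of \<open>[0, p - 1]\<close>; the quotient of
  \<open>0\<close> is \<open>-1\<close>.
\<close>

definition quo :: "nat \<Rightarrow> nat \<Rightarrow> int" where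
  "quo p t = (int t - 1) div int p"

definition rmd :: "nat \<Rightarrow> nat \<Rightarrow> nat" where
  "rmd p t = nat ((int t - 1) mod int p + 1)"

lemma quo_rmd_iff:
  assumes "p \<ge> 1"
  shows "quo p t = a \<and> rmd p t = b \<longleftrightarrow> int t = a * int p + int b \<and> b \<in> {1..p}"
proof
  have bounds: "0 \<le> (int t - 1) mod int p" "(int t - 1) mod int p < int p"
    using assms by simp_all
  assume "quo p t = a \<and> rmd p t = b"
  then have a: "a = (int t - 1) div int p" and b: "int b = (int t - 1) mod int p + 1"
    using bounds by (auto simp: quo_def rmd_def)
  have "int t - 1 = a * int p + (int b - 1)"
    unfolding a b by simp
  then show "int t = a * int p + int b \<and> b \<in> {1..p}"
    using bounds b by auto
next
  assume *: "int t = a * int p + int b \<and> b \<in> {1..p}"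
  then have t: "int t - 1 = (int b - 1) + a * int p" and b: "0 \<le> int b - 1" "int b - 1 < int p"
    by auto
  show "quo p t = a \<and> rmd p t = b"
    unfolding quo_def rmd_def t using b by simp
qed

definition g :: "nat \<Rightarrow> int \<Rightarrow> int \<Rightarrow> nat \<Rightarrow> int" where
  "g p m0 d t = quo p t * arith_seq m0 d p + arith_seq m0 d (rmd p t)"

definition u_min :: "nat \<Rightarrow> int \<Rightarrow> int \<Rightarrow> int \<Rightarrow> nat" where
  "u_min p m0 d n = (LEAST t. g p m0 d t \<notin> Apery (almost_arith_monoid p m0 d n) m0)"

definition v_min :: "nat \<Rightarrow> int \<Rightarrow> int \<Rightarrow> int \<Rightarrow> nat" where
  "v_min p m0 d n = (LEAST b. b \<ge> 1 \<and> int b * n \<in> arith_monoid p m0 d)"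

text \<open>
  The index of \<open>g\<close> below is nonnegative for \<open>k \<ge> 1\<close>: \<open>u > p\<close> when the generating set is minimal,
  so the quotient of \<open>u\<close> is at least \<open>1\<close>.
\<close>

definition gamma :: "nat \<Rightarrow> int \<Rightarrow> int \<Rightarrow> int \<Rightarrow> nat \<Rightarrow> int" where
  "gamma p m0 d n k =
     (let u = u_min p m0 d n; v = v_min p m0 d n in
        g p m0 d (nat ((quo p u - 1) * int p + int (rmd p u) + int k - 1)) + (int v - 1) * n - m0)"

end

theory Submission
  imports Defs
begin

text \<open>
  The rows are rewritings of \<open>\<gamma>\<^sub>k\<close> along \<open>g\<^sub>u = \<lambda> m\<^sub>0 + w n\<close> and \<open>v n = \<mu> m\<^sub>0 + g\<^sub>z\<close>, and such a
  matrix by itself shows \<open>\<gamma>\<^sub>k + h \<in> H\<close> for every generator \<open>h\<close>. So \<open>\<gamma>\<^sub>k \<in> PF(H)\<close> only requires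
  \<open>\<gamma>\<^sub>k \<notin> H\<close>, that is, \<open>g\<^sub>t + b n \<in> Ap(H, m\<^sub>0)\<close> for \<open>t < u\<close>, \<open>b < v\<close>. Every element of \<open>H\<close> has the
  form \<open>a m\<^sub>0 + g\<^sub>s + c n\<close>, and \<open>g\<^sub>s + g\<^sub>t - g\<^sub>s\<^sub>+\<^sub>t\<close> is \<open>0\<close> or \<open>m\<^sub>0\<close>; a counterexample
  \<open>g\<^sub>t + c n = (a + 1) m\<^sub>0 + g\<^sub>s\<close> is thus reduced to \<open>s < u\<close> by subtracting \<open>g\<^sub>u\<close>. If \<open>s \<ge> t\<close>, then
  \<open>c n \<in> H'\<close> contradicts the minimality of \<open>v\<close>. Otherwise \<open>g\<^sub>t\<^sub>-\<^sub>s + c n\<close> is a multiple of \<open>m\<^sub>0\<close>, and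
  since \<open>W = {}\<close> means \<open>z = 0\<close> or \<open>w = 0\<close>, comparing it with \<open>v n = \<mu> m\<^sub>0\<close> or with \<open>g\<^sub>u = \<lambda> m\<^sub>0\<close>
  contradicts the minimality of \<open>u\<close> or \<open>v\<close>.
\<close>

section \<open>Additive monoids spanned by sets of integers\<close>

lemma nat_span_zero: "0 \<in> nat_span S"
  unfolding nat_span_def by (rule CollectI, rule exI[of _ "\<lambda>_. 0"]) simp

lemma nat_span_add:
  assumes "x \<in> nat_span S" "y \<in> nat_span S"
  shows "x + y \<in> nat_span S"
proof -
  obtain a b :: "int \<Rightarrow> nat" where "x = (\<Sum>s\<in>S. int (a s) * s)" "y = (\<Sum>s\<in>S. int (b s) * s)"
    using assms unfolding nat_span_def by auto
  then have "x + y = (\<Sum>s\<in>S. int (a s + b s) * s)"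
    by (simp add: sum.distrib algebra_simps)
  then show ?thesis
    unfolding nat_span_def by (intro CollectI exI[of _ "\<lambda>s. a s + b s"]) simp
qed

lemma nat_span_mult:
  assumes "x \<in> nat_span S"
  shows "int k * x \<in> nat_span S"
proof (induction k)
  case (Suc k)
  then show ?case
    using nat_span_add[OF assms] by (simp add: distrib_right)
qed (simp add: nat_span_zero)

lemma nat_span_mult_nonneg:
  assumes "x \<in> nat_span S" "c \<ge> 0"
  shows "c * x \<in> nat_span S"
  using nat_span_mult[OF assms(1), of "nat c"] assms(2) by simp

lemma nat_span_base:
  assumes "finite S" "s \<in> S"
  shows "s \<in> nat_span S"
proof -
  have "(\<Sum>x\<in>S. int (if x = s then 1 else 0) * x) = (\<Sum>x\<in>S. if x = s then x else 0)"
    by (rule sum.cong) auto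
  also have "\<dots> = s"
    using assms by simp
  finally show ?thesis
    unfolding nat_span_def by (intro CollectI exI[of _ "\<lambda>x. if x = s then 1 else 0"]) simp
qed

text \<open>Serves as the induction principle for spans: later inclusions follow by checking that
  the target set is a submonoid containing the generators.\<close>

lemma nat_span_subset:
  assumes "0 \<in> X" "\<And>x y. x \<in> X \<Longrightarrow> y \<in> X \<Longrightarrow> x + y \<in> X" "S \<subseteq> X"
  shows "nat_span S \<subseteq> X"
proof
  fix x assume "x \<in> nat_span S"
  then obtain a :: "int \<Rightarrow> nat" where x: "x = (\<Sum>s\<in>S. int (a s) * s)"
    unfolding nat_span_def by auto
  have mult: "int k * s \<in> X" if "s \<in> X" for s k
  proof (induction k)
    case (Suc k)
    then show ?case
      using assms(2)[OF that] by (simp add: distrib_right)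
  qed (simp add: assms(1))
  have "(\<Sum>s\<in>T. int (a s) * s) \<in> X" if "T \<subseteq> S" for T
    using that
  proof (induction T rule: infinite_finite_induct)
    case (insert s T)
    then have "int (a s) * s \<in> X" "(\<Sum>s\<in>T. int (a s) * s) \<in> X"
      using assms(3) mult by auto
    then show ?case
      using insert.hyps assms(2) by simp
  qed (simp_all add: assms(1))
  then show "x \<in> X"
    unfolding x by blast
qed

lemma nat_span_mono:
  assumes "finite T" "S \<subseteq> T"
  shows "nat_span S \<subseteq> nat_span T"
proof (rule nat_span_subset)
  show "S \<subseteq> nat_span T"
    using assms nat_span_base by blast
qed (simp_all add: nat_span_zero nat_span_add)

lemma nat_span_nonneg:
  assumes "\<And>s. s \<in> S \<Longrightarrow> s \<ge> 0" "x \<in> nat_span S"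
  shows "x \<ge> 0"
proof -
  have "nat_span S \<subseteq> {0..}"
    by (rule nat_span_subset) (use assms(1) in auto)
  then show ?thesis
    using assms(2) by auto
qed

lemma nat_span_insertE:
  assumes "finite S" "x \<in> nat_span (insert s S)"
  obtains c y where "x = int c * s + y" "y \<in> nat_span S"
proof -
  let ?X = "{int c * s + y | c y. y \<in> nat_span S}"
  have "nat_span (insert s S) \<subseteq> ?X"
  proof (rule nat_span_subset)
    have "0 = int 0 * s + 0" by simp
    then show "0 \<in> ?X" using nat_span_zero by blast
  next
    fix a b assume "a \<in> ?X" "b \<in> ?X"
    then obtain c y c' y' where *: "a = int c * s + y" "b = int c' * s + y'"
      "y \<in> nat_span S" "y' \<in> nat_span S" by auto
    then have "a + b = int (c + c') * s + (y + y')"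
      by (simp add: algebra_simps)
    with * show "a + b \<in> ?X" using nat_span_add by blast
  next
    have "s = int 1 * s + 0" "t = int 0 * s + t" for t
      by simp_all
    then show "insert s S \<subseteq> ?X"
      using nat_span_zero nat_span_base[OF assms(1)] by blast
  qed
  then show thesis
    using assms(2) that by blast
qed

lemma nat_span_nonzeroE:
  assumes "finite S" "x \<in> nat_span S" "x \<noteq> 0"
  obtains s y where "s \<in> S" "x = s + y" "y \<in> nat_span S"
proof -
  let ?X = "insert 0 {s + y | s y. s \<in> S \<and> y \<in> nat_span S}"
  have "nat_span S \<subseteq> ?X"
  proof (rule nat_span_subset)
    fix a b assume a: "a \<in> ?X" and b: "b \<in> ?X"
    have "b \<in> nat_span S"
      using b nat_span_zero nat_span_add nat_span_base[OF assms(1)] by auto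
    then show "a + b \<in> ?X"
      using a b nat_span_add by (auto simp: add.assoc) blast
  next
    have "t = t + 0" for t :: int by simp
    then show "S \<subseteq> ?X" using nat_span_zero by blast
  qed simp
  then show thesis
    using assms(2,3) that by blast
qed

section \<open>Minimal generating sets\<close>

lemma minimal_generating_set_not_in_span:
  assumes "finite S" "minimal_generating_set S H" "s \<in> S"
  shows "s \<notin> nat_span (S - {s})"
proof
  assume s: "s \<in> nat_span (S - {s})"
  have "nat_span S \<subseteq> nat_span (S - {s})"
  proof (rule nat_span_subset)
    show "S \<subseteq> nat_span (S - {s})"
      using s nat_span_base[of "S - {s}"] assms(1) by blast
  qed (simp_all add: nat_span_zero nat_span_add)
  then have "nat_span (S - {s}) = H"
    using nat_span_mono[of S "S - {s}"] assms(1,2) unfolding minimal_generating_set_def by auto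
  then show False
    using assms(2,3) unfolding minimal_generating_set_def by blast
qed

text \<open>Write \<open>s - t = c * s + y\<close> with \<open>y\<close> generated without
  \<open>s\<close>. Positivity of \<open>s\<close> and \<open>t\<close> forces \<open>c = 0\<close>,
  so \<open>s = t + y\<close> would be redundant.\<close>

lemma minimal_generating_set_diff:
  assumes "finite S" "minimal_generating_set S H" "\<And>s. s \<in> S \<Longrightarrow> s > 0"
    and "s \<in> S" "t \<in> S" "s \<noteq> t"
  shows "s - t \<notin> H"
proof
  assume "s - t \<in> H"
  then have "s - t \<in> nat_span (insert s (S - {s}))"
    using assms(2,4) unfolding minimal_generating_set_def by (simp add: insert_absorb)
  then obtain c y where cy: "s - t = int c * s + y" "y \<in> nat_span (S - {s})"
    using nat_span_insertE assms(1) by (metis finite_Diff)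
  have "y \<ge> 0"
    using nat_span_nonneg[of "S - {s}" y] assms(3) cy(2) by force
  moreover have "t > 0" "s > 0"
    using assms by auto
  moreover have "s \<le> int c * s" if "c \<ge> 1"
    using that \<open>s > 0\<close> by simp
  ultimately have "\<not> c \<ge> 1"
    using cy(1) by linarith
  then have "s = t + y"
    using cy(1) by (cases c) auto
  then have "s \<in> nat_span (S - {s})"
    using cy(2) nat_span_add nat_span_base[of "S - {s}" t] assms(1,5,6) by auto
  then show False
    using minimal_generating_set_not_in_span[OF assms(1,2,4)] by simp
qed

section \<open>Division with remainders in \<open>{1..p}\<close> and the elements
  \<open>g\<close>\<close>

lemma quo_rmd:
  assumes "p \<ge> 1"
  shows "int t = quo p t * int p + int (rmd p t)" "1 \<le> rmd p t" "rmd p t \<le> p"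
  using quo_rmd_iff[OF assms, of t "quo p t" "rmd p t"] by auto

lemma quo_rmd_zero:
  assumes "p \<ge> 1"
  shows "quo p 0 = -1" "rmd p 0 = p"
  using quo_rmd_iff[OF assms, of 0 "-1" p] assms by auto

text \<open>The inequality is strict because remainders start at 1: \<open>t = a * p\<close> still
  has quotient \<open>a - 1\<close>.\<close>

lemma quo_ge:
  assumes "p \<ge> 1" "int t > a * int p"
  shows "quo p t \<ge> a"
proof (rule ccontr)
  assume "\<not> a \<le> quo p t"
  then have "(quo p t + 1) * int p \<le> a * int p"
    by (intro mult_right_mono) auto
  then show False
    using quo_rmd[OF assms(1), of t] assms(2) by (simp add: algebra_simps)
qed

text \<open>The carry times \<open>p\<close> is a sum of two remainders minus a third, hence
  strictly between \<open>- p\<close> and \<open>2 * p\<close>; so the carry is 0 or 1.\<close>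

lemma quo_add:
  assumes "p \<ge> 1"
  obtains "quo p (s + t) = quo p s + quo p t" | "quo p (s + t) = quo p s + quo p t + 1"
proof -
  let ?k = "quo p (s + t) - quo p s - quo p t"
  have eq: "?k * int p = int (rmd p s) + int (rmd p t) - int (rmd p (s + t))"
    using quo_rmd(1)[OF assms, of s] quo_rmd(1)[OF assms, of t] quo_rmd(1)[OF assms, of "s + t"]
    by (simp add: algebra_simps)
  have "?k * int p < 2 * int p" "(-1) * int p < ?k * int p"
    unfolding eq using quo_rmd(2,3)[OF assms, of s] quo_rmd(2,3)[OF assms, of t]
      quo_rmd(2,3)[OF assms, of "s + t"] by linarith+
  then have "?k < 2" "-1 < ?k"
    by (simp_all only: mult_less_cancel_right)
  then show thesis
    using that by linarith
qed

text \<open>Separates the part linear in \<open>t\<close> from the quotient, which turns additivity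
  of \<open>g\<close> into a question about \<open>quo\<close>.\<close>

lemma g_eq:
  assumes "p \<ge> 1"
  shows "g p m0 d t = (quo p t + 1) * m0 + int t * d"
  unfolding g_def arith_seq_def by (subst (3) quo_rmd(1)[OF assms]) (simp add: algebra_simps)

lemma g_zero: "p \<ge> 1 \<Longrightarrow> g p m0 d 0 = 0"
  by (simp add: g_eq quo_rmd_zero)

lemma g_small:
  assumes "p \<ge> 1" "1 \<le> t" "t \<le> p"
  shows "g p m0 d t = arith_seq m0 d t"
  using quo_rmd_iff[OF assms(1), of t 0 t] assms by (simp add: g_def)

text \<open>The linear parts add up, so the defect comes from the quotients alone:
  \<open>e = 1\<close> without a carry and \<open>e = 0\<close> with one.\<close>

lemma g_add:
  assumes "p \<ge> 1"
  obtains e where "e \<in> {0, 1}" "g p m0 d (s + t) = g p m0 d s + g p m0 d t - e * m0"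
proof (rule quo_add[OF assms, of s t])
  assume "quo p (s + t) = quo p s + quo p t"
  then show thesis
    by (intro that[of 1]) (simp_all add: g_eq[OF assms] algebra_simps)
next
  assume "quo p (s + t) = quo p s + quo p t + 1"
  then show thesis
    by (intro that[of 0]) (simp_all add: g_eq[OF assms] algebra_simps)
qed

lemma g_split:
  assumes "p \<ge> 1" "s \<le> t"
  obtains e where "e \<in> {0, 1}" "g p m0 d t = g p m0 d s + g p m0 d (t - s) - e * m0"
  using g_add[OF assms(1), of m0 d s "t - s"] assms(2) by auto

section \<open>Normal forms in the two monoids\<close>

lemma arith_seq_in_monoid:
  assumes "i \<le> p"
  shows "arith_seq m0 d i \<in> arith_monoid p m0 d"
  unfolding arith_monoid_def using assms by (intro nat_span_base) auto

lemma g_in_arith_monoid: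
  assumes "p \<ge> 1"
  shows "g p m0 d t \<in> arith_monoid p m0 d"
proof (cases "t = 0")
  \<comment> \<open>The quotient of 0 is -1, so the defining formula is not a nonnegative
    combination here.\<close>
  case True
  then show ?thesis
    using assms by (simp add: g_zero arith_monoid_def nat_span_zero)
next
  case False
  then have "quo p t \<ge> 0"
    using quo_ge[OF assms, of 0 t] by simp
  then show ?thesis
    using arith_seq_in_monoid[of p p m0 d] arith_seq_in_monoid[OF quo_rmd(3)[OF assms], of m0 d t]
    unfolding g_def arith_monoid_def by (intro nat_span_add nat_span_mult_nonneg) auto
qed

text \<open>A single \<open>g\<close> suffices because the defect \<open>e * m0\<close> from
  \<open>g_add\<close> is nonnegative and can be absorbed into \<open>a * m0\<close>.\<close>

lemma arith_monoid_eq: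
  assumes "p \<ge> 1"
  shows "arith_monoid p m0 d = {a * m0 + g p m0 d s | a s. a \<ge> 0}" (is "_ = ?X")
proof
  show "arith_monoid p m0 d \<subseteq> ?X"
    unfolding arith_monoid_def
  proof (rule nat_span_subset)
    have "0 = 0 * m0 + g p m0 d 0"
      using g_zero[OF assms] by simp
    then show "0 \<in> ?X" by blast
  next
    fix x y assume "x \<in> ?X" "y \<in> ?X"
    then obtain a s b t where xy: "x = a * m0 + g p m0 d s" "y = b * m0 + g p m0 d t"
      "a \<ge> 0" "b \<ge> 0" by auto
    obtain e where "e \<in> {0, 1}" "g p m0 d (s + t) = g p m0 d s + g p m0 d t - e * m0"
      using g_add[OF assms] by blast
    with xy have "x + y = (a + b + e) * m0 + g p m0 d (s + t)" "a + b + e \<ge> 0"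
      by (auto simp: algebra_simps)
    then show "x + y \<in> ?X" by blast
  next
    have "arith_seq m0 d i \<in> ?X" if "i \<le> p" for i
    proof (cases "i = 0")
      case True
      then have "arith_seq m0 d i = 1 * m0 + g p m0 d 0"
        using g_zero[OF assms] by (simp add: arith_seq_def)
      then show ?thesis by (intro CollectI exI[of _ 1] exI[of _ 0]) simp
    next
      case False
      then have "arith_seq m0 d i = 0 * m0 + g p m0 d i"
        using g_small[OF assms, of i] that by simp
      then show ?thesis by (intro CollectI exI[of _ 0] exI[of _ i]) simp
    qed
    then show "arith_seq m0 d ` {0..p} \<subseteq> ?X" by auto
  qed
next
  have "m0 \<in> arith_monoid p m0 d"
    using arith_seq_in_monoid[of 0 p m0 d] by (simp add: arith_seq_def)
  then show "?X \<subseteq> arith_monoid p m0 d"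
    using g_in_arith_monoid[OF assms, of m0 d] unfolding arith_monoid_def
    by (auto intro!: nat_span_add nat_span_mult_nonneg)
qed

lemma arith_monoid_subset: "arith_monoid p m0 d \<subseteq> almost_arith_monoid p m0 d n"
  unfolding arith_monoid_def almost_arith_monoid_def almost_arith_gens_def
  by (rule nat_span_mono) auto

lemma almost_arith_monoidI:
  assumes "p \<ge> 1" "a \<ge> 0" "b \<ge> 0"
  shows "a * m0 + g p m0 d s + b * n \<in> almost_arith_monoid p m0 d n"
proof -
  have "a * m0 + g p m0 d s \<in> almost_arith_monoid p m0 d n"
    using arith_monoid_subset arith_monoid_eq[OF assms(1), of m0 d] assms(2) by blast
  moreover have "n \<in> almost_arith_monoid p m0 d n"
    unfolding almost_arith_monoid_def almost_arith_gens_def by (rule nat_span_base) auto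
  ultimately show ?thesis
    using assms(3) unfolding almost_arith_monoid_def
    by (rule nat_span_add[OF _ nat_span_mult_nonneg])
qed

lemma almost_arith_monoidE:
  assumes "p \<ge> 1" "x \<in> almost_arith_monoid p m0 d n"
  obtains a s c where "x = a * m0 + g p m0 d s + int c * n" "a \<ge> 0"
proof -
  obtain c y where *: "x = int c * n + y" "y \<in> arith_monoid p m0 d"
    using assms(2) nat_span_insertE[of "arith_seq m0 d ` {0..p}" x n]
    unfolding almost_arith_monoid_def almost_arith_gens_def arith_monoid_def by auto
  then obtain a s where "y = a * m0 + g p m0 d s" "a \<ge> 0"
    using arith_monoid_eq[OF assms(1), of m0 d] by auto
  with * show thesis
    using that[of a s c] by simp
qed

section \<open>Elements of the Apery set\<close>

lemma g_add_multiple_in_Apery: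
  fixes lam mu m0 d n :: int and p u v w z t b :: nat
  defines "H \<equiv> almost_arith_monoid p m0 d n"
  assumes p: "p \<ge> 1"
    and Ap: "\<And>t. t < u \<Longrightarrow> g p m0 d t \<in> Apery H m0"
    and v: "\<And>b. 1 \<le> b \<Longrightarrow> b < v \<Longrightarrow> int b * n \<notin> arith_monoid p m0 d"
    and u_eq: "g p m0 d u = lam * m0 + int w * n" and lam: "lam \<ge> 1" and u_pos: "u \<ge> 1"
    and v_eq: "int v * n = mu * m0 + g p m0 d z"
    and zw: "z = 0 \<or> w = 0"
    and tb: "t < u" "b < v"
  shows "g p m0 d t + int b * n \<in> Apery H m0"
proof -
  let ?g = "g p m0 d"
  \<comment> \<open>Below \<open>u\<close>, no \<open>?g t\<close> can be rewritten with a spare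
    \<open>m0\<close>.\<close>
  have no_g: False
    if "?g t = (a + 1) * m0 + ?g s + c * n" "t < u" "a \<ge> 0" "c \<ge> 0" for t a s c
  proof -
    have "?g t - m0 = a * m0 + ?g s + c * n"
      using that by (simp add: algebra_simps)
    then have "?g t - m0 \<in> H"
      using almost_arith_monoidI[OF p that(3,4)] unfolding H_def by (simp only:)
    then show False
      using Ap[OF that(2)] by (simp add: Apery_def)
  qed
  have no_n: False if "c * n = a * m0 + ?g s" "1 \<le> c" "c < int v" "a \<ge> 0" for c a s
  proof -
    have "int (nat c) * n \<in> arith_monoid p m0 d"
      unfolding arith_monoid_eq[OF p] using that(1,2,4) by auto
    moreover have "1 \<le> nat c" "nat c < v"
      using that(2,3) by linarith+
    ultimately show False
      using v by blast
  qed
  \<comment> \<open>This is where \<open>z = 0 \<or> w = 0\<close> enters: one of the two relations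
    then involves only \<open>m0\<close> besides \<open>v * n\<close> or \<open>?g u\<close>, and
    can be subtracted from \<open>eq\<close>.\<close>
  have no_mix: False if eq: "?g t + c * n = a * m0" and t: "1 \<le> t" "t < u"
    and c: "1 \<le> c" "c < int v" for t c a
    using zw
  proof
    assume "z = 0"
    then have *: "(int v - c) * n = (mu - a) * m0 + ?g t"
      using v_eq eq g_zero[OF p, of m0 d] by (simp add: algebra_simps)
    show False
    \<comment> \<open>The sign decides which minimality is violated: either a smaller multiple of
      \<open>n\<close> lies in the arithmetic monoid, or \<open>?g t\<close> contains a spare
      \<open>m0\<close>.\<close>
    proof (cases "mu \<ge> a")
      case True
      then show False
        using c by (intro no_n[OF *]) auto
    next
      case False
      \<comment> \<open>Adding \<open>?g 0 = 0\<close> and splitting off 1 gives the shape excluded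
        by \<open>no_g\<close>.\<close>
      have "?g t = (a - mu - 1 + 1) * m0 + ?g 0 + (int v - c) * n"
        using * g_zero[OF p, of m0 d] by (simp add: algebra_simps)
      then show False
        by (rule no_g) (use False t c in auto)
    qed
  next
    assume w: "w = 0"
    obtain e where e: "?g u = ?g t + ?g (u - t) - e * m0"
      using g_split[OF p less_imp_le[OF t(2)]] by blast
    then have *: "c * n = (a - lam - e) * m0 + ?g (u - t)"
      using eq u_eq w by (simp add: algebra_simps)
    show False
    proof (cases "a - lam - e \<ge> 0")
      case True
      then show False
        using c by (intro no_n[OF *]) auto
    next
      case False
      have "?g (u - t) = (lam + e - a - 1 + 1) * m0 + ?g 0 + c * n"
        using * g_zero[OF p, of m0 d] by (simp add: algebra_simps)
      then show False
        by (rule no_g) (use False t c in auto)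
    qed
  qed
  \<comment> \<open>Descent on \<open>s\<close>. The coefficient \<open>c\<close> is an integer
    because subtracting \<open>w * n\<close> may make it negative; only \<open>c < v\<close> has to
    persist.\<close>
  have key: False
    if "?g t + c * n = (a + 1) * m0 + ?g s" "t < u" "c < int v" "a \<ge> 0" for t c a s
    using that
  proof (induction s arbitrary: c a rule: less_induct)
    case (less s)
    show False
    proof (cases "c \<le> 0")
      case True
      have "?g t = (a + 1) * m0 + ?g s + (- c) * n"
        using less.prems(1) by (simp add: algebra_simps)
      then show False
        by (rule no_g) (use less.prems True in auto)
    next
      case c: False
      consider "u \<le> s" | "t \<le> s" | "s < t"
        by (meson not_le)
      then show False
      proof cases
        case 1
        then obtain e where e: "e \<in> {0, 1}" "?g s = ?g u + ?g (s - u) - e * m0"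
          using g_split[OF p] by blast
        then have "?g t + (c - int w) * n = (a + lam - e + 1) * m0 + ?g (s - u)"
          using less.prems(1) u_eq by (simp add: algebra_simps)
        \<comment> \<open>The index drops since \<open>u \<ge> 1\<close>, and
          \<open>a + lam - e\<close> stays nonnegative since \<open>lam \<ge> 1\<close> and
          \<open>e \<le> 1\<close>.\<close>
        then show False
          by (rule less.IH[rotated]) (use less.prems e(1) lam u_pos 1 in auto)
      next
        case 2
        then obtain e where e: "e \<in> {0, 1}" "?g s = ?g t + ?g (s - t) - e * m0"
          using g_split[OF p] by blast
        then have "c * n = (a + 1 - e) * m0 + ?g (s - t)"
          using less.prems(1) by (simp add: algebra_simps)
        then show False
          by (rule no_n) (use less.prems c e(1) in auto)
      next
        case 3
        then obtain e where e: "?g t = ?g s + ?g (t - s) - e * m0"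
          using g_split[OF p less_imp_le] by blast
        have "?g (t - s) + c * n = (a + 1 + e) * m0"
          using less.prems(1) e by (simp add: algebra_simps)
        then show False
          by (rule no_mix) (use less.prems c 3 in auto)
      qed
    qed
  qed
  have "?g t + int b * n - m0 \<notin> H"
  proof
    assume "?g t + int b * n - m0 \<in> H"
    then obtain a s c where *: "?g t + int b * n - m0 = a * m0 + ?g s + int c * n" "a \<ge> 0"
      unfolding H_def by (rule almost_arith_monoidE[OF p])
    then have "?g t + (int b - int c) * n = (a + 1) * m0 + ?g s"
      by (simp add: algebra_simps)
    then show False
      by (rule key) (use tb *(2) in auto)
  qed
  moreover have "?g t + int b * n \<in> H"
    using almost_arith_monoidI[OF p, of 0 "int b" m0 d t n] unfolding H_def by simp
  ultimately show ?thesis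
    by (simp add: Apery_def)
qed

section \<open>From matrices to pseudo-Frobenius numbers\<close>

text \<open>Bridges two encodings: \<open>nat_span\<close> has one coefficient per element of a set,
  while a vector may repeat a value at several positions.\<close>

lemma nonneg_combination_in_nat_span:
  assumes "\<And>j. j < dim_vec x \<Longrightarrow> 0 \<le> y $ j" "finite S" "\<And>j. j < dim_vec x \<Longrightarrow> x $ j \<in> S"
  shows "y \<bullet> x \<in> nat_span S"
proof -
  have "(\<Sum>j\<in>J. y $ j * x $ j) \<in> nat_span S" if "J \<subseteq> {0..<dim_vec x}" for J
    using that
  proof (induction J rule: infinite_finite_induct)
    case (insert j J)
    then have j: "j < dim_vec x" and IH: "(\<Sum>j\<in>J. y $ j * x $ j) \<in> nat_span S"
      by auto
    have "y $ j * x $ j \<in> nat_span S"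
      using assms(1,3)[OF j] by (intro nat_span_mult_nonneg nat_span_base assms(2))
    then show ?case
      using insert.hyps IH by (simp add: nat_span_add)
  qed (simp_all add: nat_span_zero)
  then show ?thesis
    unfolding scalar_prod_def by blast
qed

text \<open>
  Moving the diagonal entry to the left-hand side, row \<open>i\<close> exhibits \<open>f\<close> plus the \<open>i\<close>-th generator
  as an element of the semigroup.
\<close>

lemma RF_matrixI:
  assumes f: "f \<notin> nat_span S" and S: "S = set\<^sub>v gens"
    and M: "M \<in> carrier_mat (dim_vec gens) (dim_vec gens)"
    and diag: "\<And>i. i < dim_vec gens \<Longrightarrow> M $$ (i, i) = -1"
    and off: "\<And>i j. i < dim_vec gens \<Longrightarrow> j < dim_vec gens \<Longrightarrow> i \<noteq> j \<Longrightarrow> 0 \<le> M $$ (i, j)"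
    and row: "\<And>i. i < dim_vec gens \<Longrightarrow> row M i \<bullet> gens = f"
  shows "RF_matrix (nat_span S) gens f M"
proof -
  let ?n = "dim_vec gens"
  have fin: "finite S" and mem: "gens $ i \<in> S" if "i < ?n" for i
    unfolding S vec_set_def using that by auto
  have gen: "f + gens $ i \<in> nat_span S" if i: "i < ?n" for i
  proof -
    have "(row M i + unit_vec ?n i) \<bullet> gens \<in> nat_span S"
      using M i diag[OF i] off[OF i] fin mem
      by (intro nonneg_combination_in_nat_span) (auto simp: unit_vec_def)
    moreover have "(row M i + unit_vec ?n i) \<bullet> gens = f + gens $ i"
    proof -
      have "row M i \<in> carrier_vec ?n" "gens \<in> carrier_vec ?n"
        using row_carrier[of M i] carrier_matD(2)[OF M] carrier_vec_dim_vec by metis+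
      then have "(row M i + unit_vec ?n i) \<bullet> gens = row M i \<bullet> gens + unit_vec ?n i \<bullet> gens"
        by (rule add_scalar_prod_distrib[OF _ unit_vec_carrier])
      also have "unit_vec ?n i \<bullet> gens = gens $ i"
        by (rule scalar_prod_left_unit[OF carrier_vec_dim_vec i])
      finally show ?thesis
        unfolding row[OF i] .
    qed
    ultimately show ?thesis by simp
  qed
  \<comment> \<open>Splitting one generator off \<open>h\<close> is enough, since the remaining
    summand already lies in the span.\<close>
  have "f + h \<in> nat_span S" if h: "h \<in> nat_span S" "h \<noteq> 0" for h
  proof -
    have "finite S" unfolding S vec_set_def by simp
    then obtain s y where s: "s \<in> S" "h = s + y" "y \<in> nat_span S"
      using nat_span_nonzeroE h by metis
    then obtain i where "i < ?n" "s = gens $ i"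
      unfolding S vec_set_def by auto
    then show ?thesis
      using gen[of i] s nat_span_add[of "f + s" S y] by (simp add: add.assoc)
  qed
  then have "f \<in> PF (nat_span S)"
    using f unfolding PF_def by auto
  then show ?thesis
    unfolding RF_matrix_def using assms by auto
qed

lemma set_gen_vec: "set\<^sub>v (gen_vec p m0 d n) = almost_arith_gens p m0 d n"
  unfolding vec_set_def gen_vec_def almost_arith_gens_def by (auto simp: image_iff)

theorem proposition3p1:
  fixes p u v z w :: nat and m0 d n lam mu q :: int and H :: "int set"
    and E :: "nat \<Rightarrow> int vec"
  assumes "p \<ge> 1" and "d \<ge> 1" and "m0 \<ge> 1" and "n \<ge> 1"
    and "Gcd {m0, d, n} = 1"
    and "H = almost_arith_monoid p m0 d n"
    and "n \<notin> arith_seq m0 d ` {0..p}"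
    and "minimal_generating_set (almost_arith_gens p m0 d n) H"
    and "u = u_min p m0 d n" and "v = v_min p m0 d n"
    and "z \<in> {0..u - 1}" and "w \<in> {0..v - 1}" and "lam \<ge> 1" and "mu \<ge> 0"
    and "g p m0 d u = lam * m0 + int w * n"
    and "int v * n = mu * m0 + g p m0 d z"
    and "g p m0 d (u - z) + int (v - w) * n =
           (if rmd p (u - z) < rmd p u then lam + mu + 1 else lam + mu) * m0"
    and "{u - z..u - 1} \<times> {v - w..v - 1} = {}"
    and "q = quo p u" and "rmd p u = 1" and "lam > 1"
    and "E = unit_vec (p + 2)"
  shows "\<forall>k \<in> {1..p}. \<exists>M :: int mat. RF_matrix H (gen_vec p m0 d n) (gamma p m0 d n k) M \<and>
     row M 0 = - E 0 + (q - 1) \<cdot>\<^sub>v E p + (int v - 1) \<cdot>\<^sub>v E (p + 1) + E k \<and>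
     (\<forall>j \<in> {1..p - k}.
        row M j = - E j + (q - 1) \<cdot>\<^sub>v E p + (int v - 1) \<cdot>\<^sub>v E (p + 1) + E (k + j)) \<and>
     (\<forall>j \<in> {p - k + 1..p}.
        row M j = (lam - 2) \<cdot>\<^sub>v E 0 - E j + (int w + int v - 1) \<cdot>\<^sub>v E (p + 1) + E (k + j - p - 1)) \<and>
     row M (p + 1) =
       (if mu \<ge> 1
        then (mu - 1) \<cdot>\<^sub>v E 0 + (q + quo p z - 1) \<cdot>\<^sub>v E p - E (p + 1) + E k + E (rmd p z)
        else (lam - 2) \<cdot>\<^sub>v E 0 + (quo p z - 1) \<cdot>\<^sub>v E p - E (p + 1) + E (k - 1) + E (rmd p z))"
proof
  fix k assume k: "k \<in> {1..p}"
  note p = assms(1)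
  have E_def: "E = unit_vec (p + 2)" by fact
  let ?g = "g p m0 d" and ?a = "arith_seq m0 d" and ?G = "gen_vec p m0 d n"
  let ?S = "almost_arith_gens p m0 d n"
  have fin: "finite ?S"
    unfolding almost_arith_gens_def by simp
  have pos: "s > 0" if "s \<in> ?S" for s
    using that assms(2-4) unfolding almost_arith_gens_def arith_seq_def
    by (auto intro: add_pos_nonneg)
  have H: "H = nat_span ?S"
    using assms(6) unfolding almost_arith_monoid_def .
  have gen: "?a i \<in> ?S" if "i \<le> p" for i
    using that unfolding almost_arith_gens_def by auto

  \<comment> \<open>Consequences of the choice of \<open>u\<close> and \<open>v\<close>\<close>
  have Ap: "?g t \<in> Apery H m0" if "t < u" for t
    using not_less_Least[of t "\<lambda>t. ?g t \<notin> Apery (almost_arith_monoid p m0 d n) m0"] that assms(6,9)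
    unfolding u_min_def by auto
  \<comment> \<open>The multiple \<open>m0 * n\<close> shows that the set whose least element is
    \<open>v\<close> is nonempty.\<close>
  have "int (nat m0) * n \<in> arith_monoid p m0 d"
  proof -
    have "int (nat m0) * n = int (nat n) * ?a 0"
      using assms(3,4) by (simp add: arith_seq_def)
    moreover have "?a 0 \<in> arith_monoid p m0 d"
      by (rule arith_seq_in_monoid) simp
    ultimately show ?thesis
      unfolding arith_monoid_def by (simp only: nat_span_mult)
  qed
  then have v1: "v \<ge> 1"
    using LeastI[of "\<lambda>b. b \<ge> 1 \<and> int b * n \<in> arith_monoid p m0 d" "nat m0"] assms(3,10)
    unfolding v_min_def by auto
  have vmin: "int b * n \<notin> arith_monoid p m0 d" if "1 \<le> b" "b < v" for b
    using not_less_Least[of b "\<lambda>b. b \<ge> 1 \<and> int b * n \<in> arith_monoid p m0 d"] that assms(10)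
    unfolding v_min_def by auto
  have not_Ap: "?g u \<notin> Apery H m0"
  proof -
    have "?g u - m0 = (lam - 1) * m0 + ?g 0 + int w * n"
      using assms(15) g_zero[OF p] by (simp add: algebra_simps)
    then have "?g u - m0 \<in> H"
      using almost_arith_monoidI[OF p, of "lam - 1" "int w" m0 d 0 n] assms(6,13) by simp
    then show ?thesis
      by (simp add: Apery_def)
  qed
  \<comment> \<open>Up to \<open>p\<close>, each \<open>?g t\<close> is 0 or the generator
    \<open>?a t\<close>. These lie in the Apery set, the latter by minimality of the generators,
    whereas \<open>?g u\<close> does not.\<close>
  have up: "u > p"
  proof (rule ccontr)
    assume le: "\<not> u > p"
    have "?g u \<in> Apery H m0"
    proof (cases "u = 0")
      case True
      have "- m0 \<notin> H"
        using nat_span_nonneg[of ?S "- m0"] pos assms(3) unfolding H by force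
      then show ?thesis
        using True g_zero[OF p] nat_span_zero unfolding H Apery_def by simp
    next
      case False
      then have gu: "?g u = ?a u"
        using g_small[OF p] le by simp
      have "?a u - ?a 0 \<notin> H"
        by (rule minimal_generating_set_diff[OF fin assms(8) pos])
          (use gen[of u] gen[of 0] le False assms(2) in \<open>auto simp: arith_seq_def\<close>)
      then show ?thesis
        unfolding gu Apery_def using nat_span_base[OF fin gen, of u] le H
        by (simp add: arith_seq_def)
    qed
    with not_Ap show False by simp
  qed
  \<comment> \<open>If \<open>z\<close> and \<open>w\<close> were both positive,
    \<open>(u - 1, v - 1)\<close> would belong to the product.\<close>
  have zw: "z = 0 \<or> w = 0"
    using assms(11,12,18) up v1 by auto
  have q1: "q \<ge> 1"
    using quo_ge[OF p, of 1 u] up assms(19) by simp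
  have u_eq: "int u = q * int p + 1"
    using quo_rmd(1)[OF p, of u] assms(19,20) by simp

  \<comment> \<open>The element \<open>gamma\<close> and its absence from \<open>H\<close>\<close>
  \<comment> \<open>This is the index in \<open>gamma\<close> for \<open>rmd p u = 1\<close>; it
    stays below \<open>u = q * p + 1\<close> because \<open>k \<le> p\<close>.\<close>
  define t where "t = nat ((q - 1) * int p + int k)"
  have int_t: "int t = (q - 1) * int p + int k"
    unfolding t_def using q1 by simp
  have "quo p t = q - 1 \<and> rmd p t = k"
    using quo_rmd_iff[OF p, of t "q - 1" k] int_t k by simp
  then have g_t: "?g t = (q - 1) * ?a p + ?a k"
    unfolding g_def by simp
  have tu: "t < u"
    using int_t u_eq k by (simp add: algebra_simps)
  have gamma_t: "gamma p m0 d n k = ?g t + (int v - 1) * n - m0"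
    using assms(9,10,19,20) by (simp add: gamma_def Let_def t_def)
  then have gamma: "gamma p m0 d n k = (q - 1) * ?a p + ?a k + (int v - 1) * n - ?a 0"
    using g_t by (simp add: arith_seq_def)
  have "?g t + int (v - 1) * n \<in> Apery (almost_arith_monoid p m0 d n) m0"
    by (rule g_add_multiple_in_Apery[where lam = lam and mu = mu and z = z and w = w and u = u and v = v])
      (use p Ap vmin assms(6,13,15,16) up zw tu v1 in auto)
  then have notin: "gamma p m0 d n k \<notin> H"
    using assms(6) v1 unfolding gamma_t Apery_def by (simp add: of_nat_diff)

  \<comment> \<open>The two relations in terms of generators\<close>
  have g_u: "q * ?a p + ?a 1 = lam * m0 + int w * n"
    using assms(15,19,20) by (simp add: g_def)
  have g_z: "int v * n = mu * m0 + quo p z * ?a p + ?a (rmd p z)"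
    using assms(16) by (simp add: g_def)
  note rz = quo_rmd(2,3)[OF p, of z]
  text \<open>When \<open>z = 0\<close>, the quotient is \<open>-1\<close>, but \<open>E (rmd p z) = E p\<close> compensates for it.\<close>
  have quo_z: "quo p z \<ge> 0 \<or> quo p z = -1 \<and> rmd p z = p"
    using quo_rmd_zero[OF p] quo_ge[OF p, of 0 z] by (cases "z = 0") auto
  have z_pos: "z \<noteq> 0" if "mu = 0"
  proof
    assume "z = 0"
    then have "int v * n = 0"
      using that assms(16) g_zero[OF p, of m0 d] by simp
    then show False
      using v1 assms(4) by simp
  qed
  \<comment> \<open>A zero quotient would make \<open>v * n\<close> equal to the generator
    \<open>?a (rmd p z)\<close>, which would then be redundant. The bound keeps the coefficient of
    \<open>E p\<close> in the last row nonnegative.\<close>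
  have quo_z_pos: "quo p z \<ge> 1" if "mu = 0"
  proof (rule ccontr)
    assume "\<not> quo p z \<ge> 1"
    then have "quo p z = 0"
      using quo_ge[OF p, of 0 z] z_pos[OF that] by simp
    then have eq: "?a (rmd p z) = int v * n"
      using g_z that by simp
    have "n \<in> ?S - {?a (rmd p z)}"
      using assms(7) rz unfolding almost_arith_gens_def by auto
    then have "?a (rmd p z) \<in> nat_span (?S - {?a (rmd p z)})"
      using nat_span_mult[OF nat_span_base, of "?S - {?a (rmd p z)}" n v] fin eq by simp
    then show False
      using minimal_generating_set_not_in_span[OF fin assms(8) gen[OF rz(2)]] by simp
  qed

  \<comment> \<open>The rows of the matrix\<close>
  define R where "R i =
     (if i = 0 then - E 0 + (q - 1) \<cdot>\<^sub>v E p + (int v - 1) \<cdot>\<^sub>v E (p + 1) + E k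
      else if i \<le> p - k then - E i + (q - 1) \<cdot>\<^sub>v E p + (int v - 1) \<cdot>\<^sub>v E (p + 1) + E (k + i)
      else if i \<le> p then (lam - 2) \<cdot>\<^sub>v E 0 - E i + (int w + int v - 1) \<cdot>\<^sub>v E (p + 1) + E (k + i - p - 1)
      else if mu \<ge> 1
        then (mu - 1) \<cdot>\<^sub>v E 0 + (q + quo p z - 1) \<cdot>\<^sub>v E p - E (p + 1) + E k + E (rmd p z)
        else (lam - 2) \<cdot>\<^sub>v E 0 + (quo p z - 1) \<cdot>\<^sub>v E p - E (p + 1) + E (k - 1) + E (rmd p z))" for i
  have last_row: "\<not> p + 1 \<le> p - k"
    by simp
  define M where "M = mat (p + 2) (p + 2) (\<lambda>(i, j). R i $ j)"
  have E_carrier: "E i \<in> carrier_vec (p + 2)" for i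
    unfolding E_def by simp
  have R_carrier: "R i \<in> carrier_vec (p + 2)" for i
    unfolding R_def using E_carrier by simp
  have row: "row M i = R i" if "i < p + 2" for i
    unfolding M_def using that R_carrier[of i] by (auto intro!: eq_vecI)
  have G: "?G \<in> carrier_vec (p + 2)" "dim_vec ?G = p + 2"
    unfolding gen_vec_def by auto
  have E_G: "E i \<bullet> ?G = ?a i" if "i \<le> p" for i
    using that G scalar_prod_left_unit[OF G(1), of i] unfolding E_def by (simp add: gen_vec_def)
  have E_n: "E (p + 1) \<bullet> ?G = n"
    using G scalar_prod_left_unit[OF G(1), of "p + 1"] unfolding E_def by (simp add: gen_vec_def)
  note distrib = add_scalar_prod_distrib[where n = "p + 2"] minus_scalar_prod_distrib[where n = "p + 2"]
  have row_cases [consumes 1]: thesis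
    if "i < p + 2" "i = 0 \<Longrightarrow> thesis" "\<lbrakk>i \<noteq> 0; i \<le> p - k\<rbrakk> \<Longrightarrow> thesis"
      "\<lbrakk>i > p - k; i \<le> p\<rbrakk> \<Longrightarrow> thesis" "\<lbrakk>i = p + 1; mu \<ge> 1\<rbrakk> \<Longrightarrow> thesis"
      "\<lbrakk>i = p + 1; mu = 0\<rbrakk> \<Longrightarrow> thesis" for i thesis
  proof -
    have "i \<le> p \<or> i = p + 1" "mu \<ge> 1 \<or> mu = 0"
      using that(1) assms(14) by linarith+
    then show thesis
      using that(2-) by (meson not_le)
  qed
  have R_G: "R i \<bullet> ?G = gamma p m0 d n k" if "i < p + 2" for i
  proof -
    show ?thesis
      using that
    proof (cases rule: row_cases)
      case 1
      then show ?thesis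
        unfolding R_def gamma using G E_carrier E_G E_n k
        by (simp add: distrib)
    next
      case 2
      then show ?thesis
        unfolding R_def gamma using G E_carrier E_G E_n k
        by (simp add: distrib) (simp add: arith_seq_def algebra_simps)
    next
      case 3
      then have i: "i \<noteq> 0" "k + i \<ge> p + 1" by auto
      \<comment> \<open>Comparing indices trades \<open>?a k + ?a i\<close> for
        \<open>?a p + ?a 1\<close> up to \<open>m0\<close>; then \<open>g_u\<close> replaces
        \<open>q * ?a p + ?a 1\<close>.\<close>
      then have "int (k + i - p - 1) = int k + int i - int p - 1" by simp
      then have "?a (k + i - p - 1) = ?a k + ?a i - ?a p - ?a 1 + m0"
        by (simp add: arith_seq_def algebra_simps)
      moreover have "R i \<bullet> ?G = (lam - 2) * ?a 0 - ?a i + (int w + int v - 1) * n + ?a (k + i - p - 1)"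
        unfolding R_def using 3 i G E_carrier E_G E_n k by (simp add: distrib)
      ultimately show ?thesis
        unfolding gamma using g_u by (simp add: algebra_simps arith_seq_def)
    next
      case 4
      have "R i \<bullet> ?G = (mu - 1) * ?a 0 + (q + quo p z - 1) * ?a p - n + ?a k + ?a (rmd p z)"
        unfolding R_def using 4 last_row G E_carrier E_G E_n k rz by (simp add: distrib)
      then show ?thesis
        unfolding gamma using g_z by (simp add: algebra_simps arith_seq_def)
    next
      case 5
      \<comment> \<open>With \<open>mu = 0\<close>, expanding \<open>v * n\<close> yields no
        \<open>m0\<close> to offset the \<open>- ?a 0\<close> in \<open>gamma\<close>. It is taken
        from \<open>g_u\<close>, where now \<open>w = 0\<close>; the required \<open>?a 1\<close>
        comes from lowering \<open>?a k\<close> to \<open>?a (k - 1)\<close>.\<close>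
      have w: "w = 0"
        using zw z_pos[OF 5(2)] by simp
      have a: "?a (k - 1) = ?a k - d" "?a 1 = m0 + d" "?a 0 = m0"
        using k by (simp_all add: arith_seq_def of_nat_diff algebra_simps)
      have "k - 1 \<le> p"
        using k by auto
      then have "R i \<bullet> ?G = (lam - 2) * ?a 0 + (quo p z - 1) * ?a p - n + ?a (k - 1) + ?a (rmd p z)"
        unfolding R_def using 5 last_row G E_carrier E_G E_n k rz by (simp add: distrib)
      also have "\<dots> = (q * ?a p + ?a 1) + int v * n - ?a p - n + ?a (k - 1) - 2 * m0"
        unfolding g_u g_z using 5(2) w by (simp add: algebra_simps arith_seq_def)
      also have "\<dots> = gamma p m0 d n k"
        unfolding gamma a by (simp add: algebra_simps)
      finally show ?thesis .
    qed
  qed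
  \<comment> \<open>Besides \<open>- E i\<close>, no basis vector of row \<open>i\<close> sits at
    position \<open>i\<close>, because \<open>1 \<le> k \<le> p\<close> and
    \<open>rmd p z \<le> p\<close>.\<close>
  have diag: "M $$ (i, i) = -1" if "i < p + 2" for i
    using that k rz unfolding M_def R_def E_def by auto
  have off: "0 \<le> M $$ (i, j)" if "i < p + 2" "j < p + 2" "i \<noteq> j" for i j
  proof -
    \<comment> \<open>Off the diagonal the summand \<open>- E i\<close> vanishes, so only the signs
      of the other coefficients matter.\<close>
    have E_nonneg: "0 \<le> E a $ j" and E_i: "E i $ j = 0" and E_dim: "dim_vec (E a) = p + 2" for a
      using that unfolding E_def by (auto simp: unit_vec_def)
    have "0 \<le> R i $ j"
      using that(1)
    proof (cases rule: row_cases)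
      case 1
      then have "R i $ j = (q - 1) * E p $ j + (int v - 1) * E (p + 1) $ j + E k $ j"
        using that(2) E_i by (simp add: R_def E_dim)
      then show ?thesis
        using E_nonneg q1 v1 by simp
    next
      case 2
      then have "R i $ j = (q - 1) * E p $ j + (int v - 1) * E (p + 1) $ j + E (k + i) $ j"
        using that(2) E_i by (simp add: R_def E_dim)
      then show ?thesis
        using E_nonneg q1 v1 by simp
    next
      case 3
      then have "R i $ j = (lam - 2) * E 0 $ j + (int w + int v - 1) * E (p + 1) $ j + E (k + i - p - 1) $ j"
        using that(2) E_i by (simp add: R_def E_dim)
      then show ?thesis
        using E_nonneg v1 assms(21) by simp
    next
      case 4
      have eq: "R i $ j = (mu - 1) * E 0 $ j + (q + quo p z - 1) * E p $ j + E k $ j + E (rmd p z) $ j"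
        using 4 last_row that(2) E_i by (simp add: R_def E_dim)
      show ?thesis
        using quo_z
      proof
        assume "quo p z \<ge> 0"
        then show ?thesis
          unfolding eq using E_nonneg q1 4 by simp
      next
        assume "quo p z = -1 \<and> rmd p z = p"
        then have "R i $ j = (mu - 1) * E 0 $ j + (q - 1) * E p $ j + E k $ j"
          unfolding eq by (simp add: algebra_simps)
        then show ?thesis
          using E_nonneg q1 4 by simp
      qed
    next
      case 5
      have "R i $ j = (lam - 2) * E 0 $ j + (quo p z - 1) * E p $ j + E (k - 1) $ j + E (rmd p z) $ j"
        using 5 last_row that(2) E_i by (simp add: R_def E_dim)
      then show ?thesis
        using E_nonneg quo_z_pos 5 assms(21) by simp
    qed
    then show ?thesis
      unfolding M_def using that by simp
  qed
  have "RF_matrix H ?G (gamma p m0 d n k) M"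
    unfolding H
    by (rule RF_matrixI) (use notin diag off row R_G set_gen_vec G in \<open>auto simp: H M_def\<close>)
  moreover have "row M 0 = - E 0 + (q - 1) \<cdot>\<^sub>v E p + (int v - 1) \<cdot>\<^sub>v E (p + 1) + E k"
    by (simp add: row R_def)
  moreover have "row M j = - E j + (q - 1) \<cdot>\<^sub>v E p + (int v - 1) \<cdot>\<^sub>v E (p + 1) + E (k + j)"
    if "j \<in> {1..p - k}" for j
    using that row[of j] by (auto simp: R_def)
  moreover have "row M j = (lam - 2) \<cdot>\<^sub>v E 0 - E j + (int w + int v - 1) \<cdot>\<^sub>v E (p + 1) + E (k + j - p - 1)"
    if "j \<in> {p - k + 1..p}" for j
    using that row[of j] by (auto simp: R_def)
  moreover have "row M (p + 1) =
       (if mu \<ge> 1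
        then (mu - 1) \<cdot>\<^sub>v E 0 + (q + quo p z - 1) \<cdot>\<^sub>v E p - E (p + 1) + E k + E (rmd p z)
        else (lam - 2) \<cdot>\<^sub>v E 0 + (quo p z - 1) \<cdot>\<^sub>v E p - E (p + 1) + E (k - 1) + E (rmd p z))"
    using row[of "p + 1"] last_row by (simp add: R_def)
  ultimately show "\<exists>M :: int mat. RF_matrix H (gen_vec p m0 d n) (gamma p m0 d n k) M \<and>
     row M 0 = - E 0 + (q - 1) \<cdot>\<^sub>v E p + (int v - 1) \<cdot>\<^sub>v E (p + 1) + E k \<and>
     (\<forall>j \<in> {1..p - k}.
        row M j = - E j + (q - 1) \<cdot>\<^sub>v E p + (int v - 1) \<cdot>\<^sub>v E (p + 1) + E (k + j)) \<and>
     (\<forall>j \<in> {p - k + 1..p}.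
        row M j = (lam - 2) \<cdot>\<^sub>v E 0 - E j + (int w + int v - 1) \<cdot>\<^sub>v E (p + 1) + E (k + j - p - 1)) \<and>
     row M (p + 1) =
       (if mu \<ge> 1
        then (mu - 1) \<cdot>\<^sub>v E 0 + (q + quo p z - 1) \<cdot>\<^sub>v E p - E (p + 1) + E k + E (rmd p z)
        else (lam - 2) \<cdot>\<^sub>v E 0 + (quo p z - 1) \<cdot>\<^sub>v E p - E (p + 1) + E (k - 1) + E (rmd p z))"
    by blast
qed

end
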